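(* The inequality $$u(0)^2\le\mathrm{K}_{1,2}(\theta)\,\|u\|^{2\theta}\,\|\Delta u\|^{2(1-\theta)}\qquad\text{for all }u\in l^2(\mathbb{Z})$$ holds (with a finite constant; $\mathrm{K}_{1,2}(\theta)$ denotes the sharp one) for $\theta\in[3/4,1]$. In particular, in the limiting case $\theta=3/4$, $$u(0)^2\le\frac{\sqrt2}2\,\|u\|^{3/2}\,\|\Delta u\|^{1/2},$$ with sharp constant $\mathrm{K}_{1,2}(3/4)=\sqrt2/2$. In the general case, $$\mathrm{K}_{1,2}(\theta)=\frac1{\theta^\theta(1-\theta)^{1-\theta}}\;\lambda_*(\theta)^\theta\,G_{\lambda_*(\theta)}(0),$$ where $$\lambda_*(\theta)=\frac{64\theta-32\theta^2-29+\sqrt{32\theta-23}}{2\theta^2-5\theta+3},\qquad G_\lambda(0)=\frac{\sqrt2}2\,\frac1{\lambda^{3/4}}\sqrt{\frac{\sqrt{\lambda+16}+\sqrt\lambda}{\lambda+16}}.$$ For $\theta\in[3/4,1)$ the unique (up to a constant factor) extremal is $u_{\lambda_*(\theta)}=G_{\lambda_*(\theta)}$. For $\theta=1$, $\lambda_*(1)=\infty$ (the formula for $\mathrm{K}_{1,2}$ being understood as a limit) and the extremal is $u_*=\delta$.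
   Context: Sequences are real-valued. For $u\in l^2(\mathbb{Z})$: $\Delta u(n)=u(n+1)-2u(n)+u(n-1)$, $\|\cdot\|$ is the $l^2$-norm. $\delta(0)=1$, $\delta(n)=0$ for $n\neq0$. For $\lambda>0$, $G_\lambda\in l^2(\mathbb{Z})$ is the Green's function, the solution of $(\Delta^2+\lambda)G_\lambda=\delta$; equivalently $G_\lambda(n)=\frac1\pi\int_0^\pi\frac{\cos nx\,dx}{\lambda+16\sin^4\frac x2}$. The sharp constant is the smallest constant for which the inequality holds for all $u\in l^2(\mathbb{Z})$; an extremal is a nonzero $u$ for which the inequality with the sharp constant is an equality. *)

theory Defs
  imports "HOL-Analysis.Analysis"
begin

definition l2 :: "(int \<Rightarrow> real) set" where
  "l2 = {u. (\<lambda>n. (u n)\<^sup>2) summable_on UNIV}"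

definition l2norm :: "(int \<Rightarrow> real) \<Rightarrow> real" where
  "l2norm u = sqrt (\<Sum>\<^sub>\<infinity>n. (u n)\<^sup>2)"

definition laplace :: "(int \<Rightarrow> real) \<Rightarrow> int \<Rightarrow> real" where
  "laplace u n = u (n + 1) - 2 * u n + u (n - 1)"

definition delta :: "int \<Rightarrow> real" where
  "delta n = (if n = 0 then 1 else 0)"

text \<open>
  For \<open>l > 0\<close> the equation has exactly one solution in \<open>l2\<close>;
  the value is meaningful only for such \<open>l\<close>.
\<close>
definition green :: "real \<Rightarrow> int \<Rightarrow> real" where
  "green l = (THE G. G \<in> l2 \<and> (\<forall>n. laplace (laplace G) n + l * G n = delta n))"

text \<open>
  The right-hand side of the inequality without its constant. Since \<open>0 powr 0 = 0\<close>
  (not \<open>1\<close>) in HOL, the factor \<open>l2norm (laplace u) powr 0\<close> arising for \<open>\<theta> = 1\<close> differs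
  from the usual convention only if \<open>laplace u = 0\<close>; in \<open>l2\<close> this forces \<open>u = 0\<close>, and
  then the other factor vanishes as well.
\<close>
definition interp :: "real \<Rightarrow> (int \<Rightarrow> real) \<Rightarrow> real" where
  "interp \<theta> u = l2norm u powr (2 * \<theta>) * l2norm (laplace u) powr (2 * (1 - \<theta>))"

definition admissible :: "real \<Rightarrow> real \<Rightarrow> bool" where
  "admissible \<theta> C \<longleftrightarrow> (\<forall>u\<in>l2. (u 0)\<^sup>2 \<le> C * interp \<theta> u)"

definition K12 :: "real \<Rightarrow> real" where
  "K12 \<theta> = (LEAST C. admissible \<theta> C)"

definition extremal :: "real \<Rightarrow> (int \<Rightarrow> real) \<Rightarrow> bool" where
  "extremal \<theta> u \<longleftrightarrow> u \<in> l2 \<and> u \<noteq> (\<lambda>n. 0) \<and> (u 0)\<^sup>2 = K12 \<theta> * interp \<theta> u"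

text \<open>Meaningful for \<open>\<theta> < 1\<close>; the denominator vanishes at \<open>\<theta> = 1\<close>.\<close>
definition lambda_star :: "real \<Rightarrow> real" where
  "lambda_star \<theta> =
     (64 * \<theta> - 32 * \<theta>\<^sup>2 - 29 + sqrt (32 * \<theta> - 23)) / (2 * \<theta>\<^sup>2 - 5 * \<theta> + 3)"

end

theory Submission
  imports Defs "HOL-Real_Asymp.Real_Asymp"
begin

text \<open>
  For \<open>l > 0\<close> the Green's function \<open>G\<^sub>l = green l\<close> reproduces point values in the energy form:
  \<open>u 0 = \<langle>\<Delta>u, \<Delta>G\<^sub>l\<rangle> + l \<langle>u, G\<^sub>l\<rangle>\<close>. Cauchy-Schwarz gives \<open>(u 0)\<^sup>2 \<le> G\<^sub>l(0) (\<parallel>\<Delta>u\<parallel>\<^sup>2 + l \<parallel>u\<parallel>\<^sup>2)\<close>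
  with equality only for multiples of \<open>G\<^sub>l\<close>. Choosing \<open>l\<close> by weighted AM-GM turns the right-hand side into
  \<open>l\<^sup>\<theta> G\<^sub>l(0) / (\<theta>\<^sup>\<theta> (1 - \<theta>)\<^bsup>1 - \<theta>\<^esup>)\<close> times \<open>interp \<theta> u\<close>, and \<open>l\<^sup>\<theta> G\<^sub>l(0)\<close> has a unique maximiser:
  in terms of \<open>t = sqrt (l / (l + 16))\<close> its logarithmic derivative has the sign of
  \<open>2 \<theta> - 3/2 + t / 2 - t\<^sup>2\<close>, whose only root in \<open>(0, 1)\<close> corresponds to \<open>lambda_star \<theta>\<close>.
\<close>

section \<open>The inner product of l2\<close>

definition ip :: "(int \<Rightarrow> real) \<Rightarrow> (int \<Rightarrow> real) \<Rightarrow> real" where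
  "ip u v = (\<Sum>\<^sub>\<infinity>n. u n * v n)"

lemma l2_mult_summable:
  assumes "u \<in> l2" "v \<in> l2"
  shows "(\<lambda>n. u n * v n) summable_on UNIV"
proof (rule abs_summable_summable[OF summable_on_comparison_test])
  show "(\<lambda>n. (u n)\<^sup>2 + (v n)\<^sup>2) summable_on UNIV"
    using assms unfolding l2_def by (intro summable_on_add) auto
  fix n
  have "2 * \<bar>u n\<bar> * \<bar>v n\<bar> \<le> \<bar>u n\<bar>\<^sup>2 + \<bar>v n\<bar>\<^sup>2" by (rule sum_squares_bound)
  then show "norm (u n * v n) \<le> (u n)\<^sup>2 + (v n)\<^sup>2"
    using mult_nonneg_nonneg[OF abs_ge_zero abs_ge_zero, of "u n" "v n"]
    unfolding real_norm_def abs_mult power2_abs by linarith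
qed auto

lemma l2_add:
  assumes "u \<in> l2" "v \<in> l2"
  shows "(\<lambda>n. u n + v n) \<in> l2"
proof -
  have "(\<lambda>n. ((u n)\<^sup>2 + 2 * (u n * v n)) + (v n)\<^sup>2) summable_on UNIV"
    using assms l2_mult_summable[OF assms] unfolding l2_def
    by (intro summable_on_add summable_on_cmult_right) auto
  moreover have "(\<lambda>n. ((u n)\<^sup>2 + 2 * (u n * v n)) + (v n)\<^sup>2) = (\<lambda>n. (u n + v n)\<^sup>2)"
    by (simp add: power2_sum algebra_simps)
  ultimately show ?thesis by (simp add: l2_def)
qed

lemma l2_scale: "u \<in> l2 \<Longrightarrow> (\<lambda>n. c * u n) \<in> l2"
  unfolding l2_def by (auto simp: power_mult_distrib intro: summable_on_cmult_right)

lemma bij_int_shift: "bij_betw (\<lambda>n::int. n + k) UNIV UNIV"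
  by (rule bij_betw_byWitness[where f' = "\<lambda>n. n - k"]) auto

lemma l2_shift: "u \<in> l2 \<Longrightarrow> (\<lambda>n. u (n + k)) \<in> l2"
  unfolding l2_def
  using summable_on_reindex_bij_betw[OF bij_int_shift, of "\<lambda>n. (u n)\<^sup>2" k] by simp

lemma l2_diff:
  assumes "u \<in> l2" "v \<in> l2"
  shows "(\<lambda>n. u n - v n) \<in> l2"
  using l2_add[OF assms(1) l2_scale[OF assms(2), of "-1"]] by simp

lemma l2_laplace:
  assumes "u \<in> l2"
  shows "laplace u \<in> l2"
proof -
  have "(\<lambda>n. (u (n + 1) - 2 * u n) + u (n + (-1))) \<in> l2"
    by (intro l2_add l2_diff l2_scale l2_shift assms)
  then show ?thesis by (simp add: laplace_def[abs_def])
qed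

lemma ip_commute: "ip u v = ip v u"
  by (simp add: ip_def mult.commute)

lemma ip_add_right:
  assumes "u \<in> l2" "v \<in> l2" "w \<in> l2"
  shows "ip u (\<lambda>n. v n + w n) = ip u v + ip u w"
  unfolding ip_def distrib_left
  by (intro infsum_add l2_mult_summable assms)

lemma ip_scale_right: "ip u (\<lambda>n. c * v n) = c * ip u v"
  unfolding ip_def by (simp add: mult.left_commute infsum_cmult_right')

lemma ip_diff_right:
  assumes "u \<in> l2" "v \<in> l2" "w \<in> l2"
  shows "ip u (\<lambda>n. v n - w n) = ip u v - ip u w"
  using ip_add_right[OF assms(1,2) l2_scale[OF assms(3), of "-1"]] ip_scale_right[of u "-1" w]
  by simp

text \<open>The expansion behind every completed square below: \<open>c = 1\<close> for a first
  difference, \<open>c = u 0 / green l 0\<close> for the energy bound, \<open>c = u 0\<close> with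
  \<open>v = delta\<close> for the endpoint.\<close>

lemma ip_diff_scale_self:
  assumes "u \<in> l2" "v \<in> l2"
  shows "ip (\<lambda>n. u n - c * v n) (\<lambda>n. u n - c * v n) = ip u u - 2 * c * ip u v + c\<^sup>2 * ip v v"
proof -
  let ?w = "\<lambda>n. u n - c * v n"
  have w: "?w \<in> l2" by (intro l2_diff l2_scale assms)
  have "ip ?w ?w = ip ?w u - c * ip ?w v"
    using w assms by (simp add: ip_diff_right l2_scale ip_scale_right)
  moreover have "ip ?w u = ip u u - c * ip u v" "ip ?w v = ip u v - c * ip v v"
    using assms by (simp_all add: ip_commute[of ?w] ip_commute[of v u] ip_diff_right l2_scale ip_scale_right)
  ultimately show ?thesis by (simp add: algebra_simps power2_eq_square)
qed

lemma ip_self: "ip u u = (l2norm u)\<^sup>2"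
  by (simp add: ip_def l2norm_def power2_eq_square infsum_nonneg)

lemma ip_self_nonneg: "ip u u \<ge> 0"
  by (simp add: ip_self)

lemma ip_self_eq_0:
  assumes "u \<in> l2" "ip u u = 0"
  shows "u = (\<lambda>n. 0)"
proof
  fix n
  have "(u n)\<^sup>2 = 0"
    by (rule nonneg_infsum_le_0D[where A = UNIV])
       (use assms in \<open>auto simp: l2_def ip_def power2_eq_square\<close>)
  then show "u n = 0" by simp
qed

lemma ip_self_pos: "u \<in> l2 \<Longrightarrow> u \<noteq> (\<lambda>n. 0) \<Longrightarrow> ip u u > 0"
  using ip_self_eq_0[of u] ip_self_nonneg[of u] by fastforce

section \<open>Shifts and symmetry of the discrete Laplacian\<close>

lemma ip_shift: "ip u (\<lambda>n. v (n + k)) = ip (\<lambda>n. u (n - k)) v"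
  unfolding ip_def
  using infsum_reindex_bij_betw[OF bij_int_shift, of "\<lambda>n. u (n - k) * v n" k] by simp

lemma ip_laplace_right:
  assumes "u \<in> l2" "v \<in> l2"
  shows "ip u (laplace v) = ip u (\<lambda>n. v (n + 1)) - 2 * ip u v + ip u (\<lambda>n. v (n - 1))"
proof -
  have "ip u (laplace v) = ip u (\<lambda>n. (v (n + 1) - 2 * v n) + v (n + (-1)))"
    by (simp add: laplace_def[abs_def])
  also have "\<dots> = ip u (\<lambda>n. v (n + 1)) - 2 * ip u v + ip u (\<lambda>n. v (n + (-1)))"
    using assms by (simp only: ip_add_right ip_diff_right ip_scale_right l2_diff l2_scale l2_shift)
  finally show ?thesis by simp
qed

text \<open>The shifts by \<open>1\<close> and \<open>-1\<close> are adjoint to each other, so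
  \<open>laplace\<close>, which contains both with equal weight, is symmetric.\<close>

lemma ip_laplace:
  assumes "u \<in> l2" "v \<in> l2"
  shows "ip u (laplace v) = ip (laplace u) v"
proof -
  have "ip u (\<lambda>n. v (n + 1)) = ip v (\<lambda>n. u (n - 1))"
    using ip_shift[of u v 1] ip_commute[of v "\<lambda>n. u (n - 1)"] by simp
  moreover have "ip u (\<lambda>n. v (n - 1)) = ip v (\<lambda>n. u (n + 1))"
    using ip_shift[of u v "-1"] ip_commute[of v "\<lambda>n. u (n + 1)"] by simp
  ultimately show ?thesis
    using ip_laplace_right[OF assms] ip_laplace_right[OF assms(2,1)]
      ip_commute[of "laplace u" v] ip_commute[of u v] by linarith
qed

lemma laplace_diff_scale:
  "laplace (\<lambda>n. u n - c * v n) = (\<lambda>n. laplace u n - c * laplace v n)"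
  by (auto simp: laplace_def algebra_simps)

section \<open>The unit sequence \<open>delta\<close> and the kernel of the Laplacian\<close>

lemma has_sum_delta: "((\<lambda>n. f n * delta n) has_sum f 0) UNIV"
proof -
  have "((\<lambda>n. f n * delta n) has_sum (\<Sum>n\<in>{0}. f n * delta n)) {0}"
    by (intro has_sum_finite) auto
  then show ?thesis
    by (subst has_sum_cong_neutral[where T = "{0}" and g = "\<lambda>n. f n * delta n"])
       (auto simp: delta_def)
qed

lemma ip_delta: "ip u delta = u 0"
  unfolding ip_def by (rule infsumI[OF has_sum_delta])

lemma delta_l2: "delta \<in> l2"
  using has_sum_imp_summable[OF has_sum_delta[of delta]] by (simp add: l2_def power2_eq_square)

text \<open>Summation by parts turns \<open>laplace u = 0\<close> into the vanishing of the first difference of \<open>u\<close>,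
  and a constant sequence in \<open>l2\<close> is zero.\<close>
lemma laplace_eq_0:
  assumes u: "u \<in> l2" and 0: "laplace u = (\<lambda>n. 0)"
  shows "u = (\<lambda>n. 0)"
proof -
  let ?s = "\<lambda>n. u (n + 1)"
  have s: "?s \<in> l2" by (rule l2_shift[OF u])
  have d: "(\<lambda>n. ?s n - 1 * u n) \<in> l2" using l2_diff[OF s u] by simp
  have ss: "ip ?s ?s = ip u u" using ip_shift[of ?s u 1] by simp
  \<comment> \<open>Both shifts of \<open>u\<close> have the same product with \<open>u\<close>, so
    \<open>ip u (laplace u) = 0\<close> says that \<open>ip ?s u = ip u u\<close>: the equality case
    of Cauchy-Schwarz.\<close>
  have "ip u (\<lambda>n. u (n + (-1))) = ip ?s u" using ip_shift[of u u "-1"] by simp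
  moreover have "ip u (laplace u) = 0" by (simp add: 0 ip_def)
  ultimately have "ip ?s u = ip u u"
    using ip_laplace_right[OF u u] by (simp add: ip_commute[of u ?s])
  then have "ip (\<lambda>n. ?s n - 1 * u n) (\<lambda>n. ?s n - 1 * u n) = 0"
    using ip_diff_scale_self[OF s u, of 1] ss by simp
  from ip_self_eq_0[OF d this] have step: "u (n + 1) = u n" for n
    by (metis (no_types) diff_eq_eq mult_1 add_0)
  have const: "u n = u 0" for n
  proof (induction n rule: int_induct[where k = 0])
    case (step2 i)
    then show ?case using step[of "i - 1"] by simp
  qed (use step in auto)
  have "u 0 = 0"
  proof (rule ccontr)
    assume "u 0 \<noteq> 0"
    have "(\<lambda>n::int. (u 0)\<^sup>2) summable_on UNIV"
      using u const unfolding l2_def by (metis (no_types, lifting) mem_Collect_eq summable_on_cong)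
    then have "(\<lambda>n::int. (u 0)\<^sup>2) summable_on range int"
      by (rule summable_on_subset_banach) simp
    then have "(\<lambda>k::nat. (u 0)\<^sup>2) summable_on UNIV"
      by (subst (asm) summable_on_reindex) (auto simp: o_def)
    then have "summable (\<lambda>k::nat. (u 0)\<^sup>2)"
      by (rule summable_on_imp_summable)
    then show False using \<open>u 0 \<noteq> 0\<close> by (simp add: summable_const_iff)
  qed
  with const show ?thesis by auto
qed

section \<open>The Green's function\<close>

lemma summable_on_geometric_int:
  fixes r :: real
  assumes "0 \<le> r" "r < 1"
  shows "(\<lambda>n::int. r ^ nat \<bar>n\<bar>) summable_on UNIV"
proof -
  have s: "(\<lambda>k::nat. r ^ k) summable_on UNIV"
    using assms by (intro summable_nonneg_imp_summable_on summable_geometric) auto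
  have "(\<lambda>n::int. r ^ nat \<bar>n\<bar>) summable_on range int"
    using s by (subst summable_on_reindex) (auto simp: o_def)
  moreover have "(\<lambda>n::int. r ^ nat \<bar>n\<bar>) summable_on range (\<lambda>k. - int k)"
    using s by (subst summable_on_reindex) (auto simp: o_def inj_on_def)
  ultimately have "(\<lambda>n::int. r ^ nat \<bar>n\<bar>) summable_on (range int \<union> range (\<lambda>k. - int k))"
    by (rule summable_on_union)
  moreover have "range int \<union> range (\<lambda>k. - int k) = UNIV"
  proof (intro equalityI subsetI)
    fix n :: int
    show "n \<in> range int \<union> range (\<lambda>k. - int k)"
      by (cases n rule: int_cases2) auto
  qed auto
  ultimately show ?thesis by simp
qed

text \<open>For \<open>norm q < 1\<close> and \<open>z = q + 1 / q\<close> this is the decaying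
  fundamental solution of \<open>laplace - (z - 2)\<close>: the powers of \<open>q\<close> and
  \<open>1 / q\<close> solve the homogeneous recursion, they are glued at 0, and
  \<open>q - 1 / q\<close> normalises the jump there.\<close>

definition resolvent_kernel :: "complex \<Rightarrow> int \<Rightarrow> complex" where
  "resolvent_kernel q n = q ^ nat \<bar>n\<bar> / (q - 1 / q)"

lemma resolvent_kernel_eq:
  assumes q: "q \<noteq> 0" "q - 1 / q \<noteq> 0" and z: "q + 1 / q = z"
  shows "resolvent_kernel q (n + 1) + resolvent_kernel q (n - 1) - z * resolvent_kernel q n
           = of_real (delta n)"
proof -
  have pow: "q ^ Suc (Suc k) + q ^ k = z * q ^ Suc k" for k
    using q(1) by (simp add: z[symmetric] field_simps)
  consider "n = 0" | "n > 0" | "n < 0" by linarith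
  then show ?thesis
  proof cases
    case 1
    have "(q + q - z) / (q - 1 / q) = 1"
      using q(2) by (simp add: z[symmetric])
    then show ?thesis
      using 1 by (simp add: resolvent_kernel_def delta_def add_divide_distrib diff_divide_distrib)
  next
    case 2
    define k where "k = nat (n - 1)"
    have "nat \<bar>n + 1\<bar> = Suc (Suc k)" "nat \<bar>n\<bar> = Suc k" "nat \<bar>n - 1\<bar> = k"
      using 2 by (auto simp: k_def)
    then show ?thesis using pow[of k] 2
      by (simp add: resolvent_kernel_def delta_def add_divide_distrib[symmetric])
  next
    case 3
    define k where "k = nat (- n - 1)"
    have "nat \<bar>n - 1\<bar> = Suc (Suc k)" "nat \<bar>n\<bar> = Suc k" "nat \<bar>n + 1\<bar> = k"
      using 3 by (auto simp: k_def)
    then show ?thesis using pow[of k] 3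
      by (simp add: resolvent_kernel_def delta_def add_divide_distrib[symmetric] add.commute)
  qed
qed

lemma Im_resolvent_kernel_l2:
  assumes "norm q < 1"
  shows "(\<lambda>n. Im (resolvent_kernel q n)) \<in> l2"
proof -
  have "(\<lambda>n::int. ((norm q)\<^sup>2) ^ nat \<bar>n\<bar> * (1 / (norm (q - 1 / q))\<^sup>2)) summable_on UNIV"
    by (intro summable_on_cmult_left summable_on_geometric_int zero_le_power2)
       (use assms abs_square_less_1[of "norm q"] in simp)
  then have "(\<lambda>n. (Im (resolvent_kernel q n))\<^sup>2) summable_on UNIV"
  proof (rule summable_on_comparison_test)
    fix n
    have "\<bar>Im (resolvent_kernel q n)\<bar>\<^sup>2 \<le> (norm (resolvent_kernel q n))\<^sup>2"
      by (intro power_mono abs_Im_le_cmod) auto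
    also have "\<dots> = ((norm q)\<^sup>2) ^ nat \<bar>n\<bar> * (1 / (norm (q - 1 / q))\<^sup>2)"
      by (simp add: resolvent_kernel_def norm_divide norm_power power_divide power_mult[symmetric] mult.commute)
    finally show "(Im (resolvent_kernel q n))\<^sup>2 \<le> ((norm q)\<^sup>2) ^ nat \<bar>n\<bar> * (1 / (norm (q - 1 / q))\<^sup>2)"
      by simp
  qed auto
  then show ?thesis by (simp add: l2_def)
qed

text \<open>The two roots of \<open>q\<^sup>2 - z * q + 1\<close> have product 1, so one of them is
  in the open disc unless both lie on the unit circle. There they would be conjugate and
  \<open>z\<close> real, against \<open>m > 0\<close>.\<close>

lemma exists_root_in_disc:
  assumes "m > 0"
  obtains q where "q \<noteq> 0" "norm q < 1" "q + 1 / q = Complex 2 m"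
proof -
  define z where "z = Complex 2 m"
  define s where "s = csqrt (z\<^sup>2 - 4)"
  define a b where "a = (z + s) / 2" and "b = (z - s) / 2"
  have s2: "s\<^sup>2 = z\<^sup>2 - 4" by (simp add: s_def)
  have ab: "a * b = 1" using s2 by (simp add: a_def b_def field_simps power2_eq_square)
  then have nz: "a \<noteq> 0" "b \<noteq> 0" by auto
  have inv: "1 / a = b" "1 / b = a" using ab nz by (simp_all add: field_simps)
  have sum: "a + b = z" by (simp add: a_def b_def field_simps)
  have no: "norm a \<noteq> 1"
  proof
    assume "norm a = 1"
    then have "b = cnj a"
      using inv(1) by (simp add: complex_div_cnj[of 1 a])
    then have "Im z = 0" using sum by auto
    then show False using assms by (simp add: z_def)
  qed
  have prod: "norm a * norm b = 1" using ab by (metis norm_mult norm_one)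
  show ?thesis
  proof (cases "norm a < 1")
    case True
    then show ?thesis using that[of a] nz inv sum by (simp add: z_def)
  next
    case False
    then have "norm a > 1" using no by simp
    then have "norm b < 1" using prod nz
      by (metis mult_less_cancel_right1 norm_le_zero_iff)
    then show ?thesis using that[of b] nz inv sum by (simp add: z_def add.commute)
  qed
qed

text \<open>The difference \<open>v\<close> solves the homogeneous equation; pairing that with
  \<open>v\<close> gives vanishing energy, hence \<open>v = 0\<close>.\<close>

lemma green_equation_unique:
  assumes l: "l > 0"
    and G: "G \<in> l2" "\<And>n. laplace (laplace G) n + l * G n = delta n"
    and H: "H \<in> l2" "\<And>n. laplace (laplace H) n + l * H n = delta n"
  shows "G = H"
proof -
  \<comment> \<open>The factor 1 gives \<open>v\<close> the shape that
    \<open>laplace_diff_scale\<close> rewrites.\<close>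
  define v where "v = (\<lambda>n. G n - 1 * H n)"
  have v: "v \<in> l2" using l2_diff[OF G(1) H(1)] by (simp add: v_def)
  have "laplace (laplace v) n + l * v n = 0" for n
    unfolding v_def laplace_diff_scale using G(2)[of n] H(2)[of n] by (simp add: algebra_simps)
  then have "(\<lambda>n. laplace (laplace v) n + l * v n) = (\<lambda>n. 0)" by auto
  then have "ip v (\<lambda>n. laplace (laplace v) n + l * v n) = 0" by (simp add: ip_def)
  then have "ip (laplace v) (laplace v) + l * ip v v = 0"
    using v by (simp add: ip_add_right l2_laplace l2_scale ip_scale_right ip_laplace)
  then have "ip v v = 0"
    using l ip_self_nonneg[of v] ip_self_nonneg[of "laplace v"]
    by (smt (verit) mult_pos_pos)
  from ip_self_eq_0[OF v this] show ?thesis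
    by (auto simp: v_def fun_eq_iff)
qed

text \<open>With \<open>m = sqrt l\<close> the operator factors as \<open>(laplace - \<i> m) (laplace + \<i> m)\<close>, and the imaginary part
  of the kernel of the first factor's inverse is \<open>m\<close> times the Green's function.\<close>
lemma green_explicit:
  assumes l: "l > 0" and q: "q \<noteq> 0" "norm q < 1" "q + 1 / q = Complex 2 (sqrt l)"
  shows "green l = (\<lambda>n. Im (resolvent_kernel q n) / sqrt l)"
    and "green l \<in> l2"
    and "laplace (laplace (green l)) n + l * green l n = delta n"
proof -
  define m where "m = sqrt l"
  have m: "m > 0" "m * m = l" using l by (simp_all add: m_def)
  let ?R = "resolvent_kernel q"
  define G where "G = (\<lambda>n. 1 / m * Im (?R n))"
  have "q - 1 / q \<noteq> 0"
  proof
    assume "q - 1 / q = 0"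
    then have "q * q = 1" using q(1) by (simp add: field_simps)
    then have "(norm q)\<^sup>2 = 1" by (metis norm_mult norm_one power2_eq_square)
    then show False using q(2) norm_ge_zero[of q] by (simp add: power2_eq_1_iff)
  qed
  from resolvent_kernel_eq[OF q(1) this q(3)]
  have eq: "?R (n + 1) + ?R (n - 1) - Complex 2 m * ?R n = of_real (delta n)" for n
    by (simp add: m_def)
  \<comment> \<open>The imaginary part of the kernel equation becomes
    \<open>laplace G = Re R\<close>. The real part becomes the equation of the Green's function,
    because \<open>m * Im R = l * G\<close>.\<close>
  have re: "Re (?R (n + 1)) + Re (?R (n - 1)) - 2 * Re (?R n) + m * Im (?R n) = delta n" for n
    using arg_cong[OF eq[of n], of Re] by simp
  have im: "Im (?R (n + 1)) + Im (?R (n - 1)) - 2 * Im (?R n) - m * Re (?R n) = 0" for n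
    using arg_cong[OF eq[of n], of Im] by simp
  have G1: "laplace G = (\<lambda>n. Re (?R n))"
  proof
    fix n
    have "m * laplace G n = m * Re (?R n)"
      using im[of n] m(1) by (simp add: laplace_def G_def field_simps)
    then show "laplace G n = Re (?R n)" using m by simp
  qed
  have G2: "laplace (laplace G) n + l * G n = delta n" for n
    unfolding G1 using re[of n] m(1) by (simp add: laplace_def G_def m(2)[symmetric])
  have Gl2: "G \<in> l2"
    unfolding G_def by (intro l2_scale Im_resolvent_kernel_l2 q)
  have "green l = G"
    unfolding green_def
    by (rule the_equality) (use Gl2 G2 green_equation_unique[OF l] in auto)
  then show "green l = (\<lambda>n. Im (?R n) / sqrt l)" "green l \<in> l2"
    "laplace (laplace (green l)) n + l * green l n = delta n"
    using Gl2 G2 by (auto simp: G_def m_def)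
qed

section \<open>Reproducing property and value at the origin\<close>

lemma
  assumes "l > 0"
  shows green_l2: "green l \<in> l2"
    and green_equation: "laplace (laplace (green l)) n + l * green l n = delta n"
proof -
  from assms have "sqrt l > 0" by simp
  then obtain q where "q \<noteq> 0" "norm q < 1" "q + 1 / q = Complex 2 (sqrt l)"
    by (rule exists_root_in_disc)
  from green_explicit(2,3)[OF assms this]
  show "green l \<in> l2" "laplace (laplace (green l)) n + l * green l n = delta n" .
qed

text \<open>Pair the equation of \<open>green l\<close> with \<open>u\<close> and move one of the
  two Laplacians across by symmetry.\<close>

lemma green_reproducing:
  assumes l: "l > 0" and u: "u \<in> l2"
  shows "ip (laplace u) (laplace (green l)) + l * ip u (green l) = u 0"
proof -
  let ?G = "green l"
  note G = green_l2[OF l]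
  have "u 0 = ip u (\<lambda>n. laplace (laplace ?G) n + l * ?G n)"
    using green_equation[OF l] ip_delta[of u] by presburger
  also have "\<dots> = ip u (laplace (laplace ?G)) + l * ip u ?G"
    using u G by (simp add: ip_add_right l2_laplace l2_scale ip_scale_right)
  also have "ip u (laplace (laplace ?G)) = ip (laplace u) (laplace ?G)"
    using u G by (simp add: ip_laplace l2_laplace)
  finally show ?thesis by simp
qed

lemma green_nonzero:
  assumes "l > 0"
  shows "green l \<noteq> (\<lambda>n. 0)"
  using green_equation[OF assms, of 0] by (auto simp: laplace_def delta_def)

text \<open>By the reproducing property \<open>green l 0\<close> is the energy of
  \<open>green l\<close> itself.\<close>

lemma green_zero_pos:
  assumes "l > 0"
  shows "green l 0 > 0"
proof -
  have "l * ip (green l) (green l) > 0"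
    by (intro mult_pos_pos assms ip_self_pos green_l2 green_nonzero)
  then show ?thesis
    using green_reproducing[OF assms green_l2[OF assms]] ip_self_nonneg[of "laplace (green l)"]
    by linarith
qed

text \<open>The value at 0 is read off \<open>w = q - 1/q\<close>, where only \<open>w\<^sup>2\<close> is needed: positivity of \<open>green l 0\<close>
  selects the sign.\<close>
lemma green_zero:
  assumes l: "l > 0"
  shows "green l 0 = sqrt 2 / 2 * (1 / l powr (3/4)) * sqrt ((sqrt (l + 16) + sqrt l) / (l + 16))"
proof -
  define m p where "m = sqrt l" and "p = sqrt (l + 16)"
  have m: "m > 0" "m\<^sup>2 = l" using l by (simp_all add: m_def)
  have p: "p > 0" "p\<^sup>2 = l + 16" using l by (simp_all add: p_def)
  obtain q where q: "q \<noteq> 0" "norm q < 1" "q + 1 / q = Complex 2 m"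
    using exists_root_in_disc[OF m(1)] .
  define w where "w = q - 1 / q"
  have "w\<^sup>2 = (q + 1 / q)\<^sup>2 - 4"
    using q(1) by (simp add: w_def power2_eq_square field_simps)
  then have w2: "w\<^sup>2 = Complex (- l) (4 * m)"
    using m by (simp add: q(3) complex_eq_iff power2_eq_square mult.commute)
  \<comment> \<open>The squared modulus of \<open>w\<^sup>2\<close> is
    \<open>l\<^sup>2 + 16 * l = l * (l + 16)\<close>, that is \<open>(m * p)\<^sup>2\<close>. With
    the real part of \<open>w\<^sup>2\<close> this determines \<open>(Im w)\<^sup>2\<close>.\<close>
  have "(norm w)\<^sup>2 = norm (w\<^sup>2)" by (simp add: norm_power)
  also have "\<dots> = sqrt ((m * p)\<^sup>2)"
    unfolding w2 by (simp add: complex_norm power_mult_distrib p(2) m(2)) (simp add: power2_eq_square algebra_simps)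
  finally have nw: "(norm w)\<^sup>2 = m * p" using m p by simp
  have "(Re w)\<^sup>2 - (Im w)\<^sup>2 = - l" using arg_cong[OF w2, of Re] by (simp add: Re_power2)
  moreover have "(Re w)\<^sup>2 + (Im w)\<^sup>2 = m * p" using nw by (simp add: cmod_power2)
  ultimately have im: "(Im w)\<^sup>2 = m * (p + m) / 2"
    using m(2) by (simp add: power2_eq_square field_simps)
  have "green l 0 = Im (1 / w) / m"
    using green_explicit(1)[OF l q(1,2)] q(3) by (simp add: resolvent_kernel_def m_def w_def)
  also have "Im (1 / w) = - Im w / (m * p)"
    using nw by (simp add: Im_divide cmod_power2)
  finally have "(green l 0)\<^sup>2 = (Im w)\<^sup>2 / ((m * p)\<^sup>2 * m\<^sup>2)"
    by (simp add: power_divide power_mult_distrib)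
  also have "\<dots> = 1 / 2 * (1 / m ^ 3) * ((p + m) / (l + 16))"
    unfolding im p(2)[symmetric] using m(1) p(1) by (simp add: field_simps power2_eq_square power3_eq_cube)
  also have "\<dots> = (sqrt 2 / 2 * (1 / l powr (3/4)) * sqrt ((p + m) / (l + 16)))\<^sup>2"
  proof -
    have "(l powr (3/4))\<^sup>2 = l powr (3/2)"
      using l by (simp add: powr_powr powr_realpow[symmetric])
    also have "\<dots> = (l powr (1/2)) powr 3" using l by (simp add: powr_powr)
    also have "\<dots> = m ^ 3" using l m by (simp add: powr_half_sqrt m_def powr_numeral)
    finally show ?thesis
      using m p l by (simp add: power_mult_distrib power_divide)
         (use m p l in \<open>simp add: divide_simps\<close>)
  qed
  finally have "green l 0 = sqrt 2 / 2 * (1 / l powr (3/4)) * sqrt ((p + m) / (l + 16))"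
    using green_zero_pos[OF l] m p l by (subst (asm) power2_eq_iff_nonneg) auto
  then show ?thesis by (simp add: m_def p_def)
qed

section \<open>The sharp inequality\<close>

text \<open>Completing the square: the energy of \<open>u - (u 0 / green l 0) * green l\<close> is nonnegative.\<close>
lemma
  assumes l: "l > 0" and u: "u \<in> l2"
  shows green_inequality: "(u 0)\<^sup>2 \<le> green l 0 * (ip (laplace u) (laplace u) + l * ip u u)"
    and green_inequality_eq: "(u 0)\<^sup>2 = green l 0 * (ip (laplace u) (laplace u) + l * ip u u)
           \<Longrightarrow> u = (\<lambda>n. u 0 / green l 0 * green l n)"
proof -
  let ?G = "green l"
  define g c where "g = ?G 0" and "c = u 0 / g"
  define v where "v = (\<lambda>n. u n - c * ?G n)"
  define E where "E = ip (laplace v) (laplace v) + l * ip v v"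
  note G = green_l2[OF l]
  have g: "g > 0" using green_zero_pos[OF l] by (simp add: g_def)
  have v: "v \<in> l2" unfolding v_def by (intro l2_diff l2_scale u G)
  have "E = ip (laplace u) (laplace u) + l * ip u u
      - 2 * c * (ip (laplace u) (laplace ?G) + l * ip u ?G)
      + c\<^sup>2 * (ip (laplace ?G) (laplace ?G) + l * ip ?G ?G)"
    unfolding E_def v_def laplace_diff_scale ip_diff_scale_self[OF u G]
      ip_diff_scale_self[OF l2_laplace[OF u] l2_laplace[OF G]]
    by (simp add: algebra_simps)
  \<comment> \<open>The mixed energy of \<open>u\<close> and \<open>green l\<close> is
    \<open>u 0\<close>, and the energy of \<open>green l\<close> is \<open>g\<close>.\<close>
  also have "\<dots> = ip (laplace u) (laplace u) + l * ip u u - 2 * c * u 0 + c\<^sup>2 * g"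
    by (simp only: green_reproducing[OF l u] green_reproducing[OF l G] g_def)
  also have "\<dots> = ip (laplace u) (laplace u) + l * ip u u - (u 0)\<^sup>2 / g"
    using g by (simp add: c_def field_simps power2_eq_square)
  finally have E: "g * E = g * (ip (laplace u) (laplace u) + l * ip u u) - (u 0)\<^sup>2"
    using g by (simp add: right_diff_distrib)
  have E1: "E \<ge> l * ip v v" using ip_self_nonneg by (simp add: E_def)
  moreover have "l * ip v v \<ge> 0" using l ip_self_nonneg by simp
  ultimately have "g * E \<ge> 0" using g by simp
  with E show "(u 0)\<^sup>2 \<le> ?G 0 * (ip (laplace u) (laplace u) + l * ip u u)"
    by (simp add: g_def)
  assume "(u 0)\<^sup>2 = ?G 0 * (ip (laplace u) (laplace u) + l * ip u u)"
  with E g have "E = 0" by (simp add: g_def)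
  with E1 have "l * ip v v \<le> 0" by simp
  with l ip_self_nonneg[of v] have "ip v v = 0"
    by (simp add: mult_le_0_iff)
  from fun_cong[OF ip_self_eq_0[OF v this]] have "u n = u 0 / ?G 0 * ?G n" for n
    unfolding v_def c_def g_def by (rule eq_iff_diff_eq_0[THEN iffD2])
  then show "u = (\<lambda>n. u 0 / ?G 0 * ?G n)" by (rule ext)
qed

section \<open>Interpolation products and weighted AM-GM\<close>

lemma interp_ip: "interp \<theta> u = ip u u powr \<theta> * ip (laplace u) (laplace u) powr (1 - \<theta>)"
proof -
  have "l2norm v powr (2 * a) = ip v v powr a" for v a
    unfolding powr_powr[symmetric] by (simp add: ip_self l2norm_def infsum_nonneg)
  then show ?thesis by (simp only: interp_def)
qed

lemma interp_pos:
  assumes "u \<in> l2" "u \<noteq> (\<lambda>n. 0)"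
  shows "ip u u > 0" "ip (laplace u) (laplace u) > 0" "interp \<theta> u > 0"
proof -
  show *: "ip u u > 0" "ip (laplace u) (laplace u) > 0"
    using assms laplace_eq_0[OF assms(1)] by (auto intro!: ip_self_pos l2_laplace)
  then show "interp \<theta> u > 0" by (simp add: interp_ip)
qed

text \<open>The constant of weighted AM-GM: for positive \<open>A\<close>, \<open>B\<close> and
  \<open>0 < \<theta> < 1\<close>, the minimum of \<open>(A + l * B) / l powr \<theta>\<close> over
  \<open>l > 0\<close> is \<open>young_const \<theta> * (B powr \<theta> * A powr (1 -
  \<theta>))\<close>.\<close>

definition young_const :: "real \<Rightarrow> real" where
  "young_const \<theta> = 1 / (\<theta> powr \<theta> * (1 - \<theta>) powr (1 - \<theta>))"

lemma young_const_pos: "0 < \<theta> \<Longrightarrow> \<theta> < 1 \<Longrightarrow> young_const \<theta> > 0"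
  by (simp add: young_const_def)

text \<open>Equality case of weighted AM-GM: \<open>bal\<close> says that \<open>l * B\<close> and
  \<open>A\<close> are the shares \<open>\<theta>\<close> and \<open>1 - \<theta>\<close> of their
  sum.\<close>

lemma young_eq:
  fixes A B l \<theta> :: real
  assumes \<theta>: "0 < \<theta>" "\<theta> < 1" and pos: "A > 0" "B > 0" "l > 0"
    and bal: "(1 - \<theta>) * (l * B) = \<theta> * A"
  shows "A + l * B = young_const \<theta> * l powr \<theta> * (B powr \<theta> * A powr (1 - \<theta>))"
proof -
  define S where "S = A + l * B"
  have S: "S > 0" using pos by (simp add: S_def add_pos_pos)
  have B: "l * B = \<theta> * S"
    using bal unfolding S_def distrib_left left_diff_distrib by linarith
  then have A: "A = (1 - \<theta>) * S"
    unfolding left_diff_distrib using S_def by linarith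
  define P where "P = \<theta> powr \<theta> * (1 - \<theta>) powr (1 - \<theta>)"
  have P: "P \<noteq> 0" using \<theta> by (simp add: P_def)
  have "l powr \<theta> * (B powr \<theta> * A powr (1 - \<theta>)) = (l * B) powr \<theta> * A powr (1 - \<theta>)"
    using pos by (simp add: powr_mult)
  also have "\<dots> = P * (S powr \<theta> * S powr (1 - \<theta>))"
    unfolding A B P_def using \<theta> S by (simp add: powr_mult)
  also have "S powr \<theta> * S powr (1 - \<theta>) = S"
    using S by (simp add: powr_add[symmetric])
  finally have "1 / P * (l powr \<theta> * (B powr \<theta> * A powr (1 - \<theta>))) = S"
    using P by simp
  then show ?thesis
    by (simp only: S_def P_def young_const_def mult.assoc)
qed

text \<open>The parameter is chosen to balance the two energies of \<open>u\<close>. The passage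
  from sum to product is then exact, so equality here is equality in the energy bound.\<close>

lemma green_upper_bound:
  assumes \<theta>: "0 < \<theta>" "\<theta> < 1" and u: "u \<in> l2" "u \<noteq> (\<lambda>n. 0)"
  obtains l where "l > 0" "(u 0)\<^sup>2 \<le> young_const \<theta> * (l powr \<theta> * green l 0) * interp \<theta> u"
    "(u 0)\<^sup>2 = young_const \<theta> * (l powr \<theta> * green l 0) * interp \<theta> u
      \<Longrightarrow> u = (\<lambda>n. u 0 / green l 0 * green l n)"
proof -
  let ?A = "ip (laplace u) (laplace u)" and ?B = "ip u u"
  define l where "l = \<theta> / (1 - \<theta>) * (?A / ?B)"
  note pos = interp_pos[OF u]
  have l: "l > 0" using \<theta> pos by (simp add: l_def)
  have "(1 - \<theta>) * (l * ?B) = \<theta> * ?A" using \<theta> pos(1,2) by (simp add: l_def)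
  from young_eq[OF \<theta> pos(2,1) l this]
  have "green l 0 * (?A + l * ?B) = young_const \<theta> * (l powr \<theta> * green l 0) * interp \<theta> u"
    by (simp add: interp_ip)
  with green_inequality[OF l u(1)] green_inequality_eq[OF l u(1)] l that show ?thesis by metis
qed

section \<open>The maximiser of \<open>l powr \<theta> * green l 0\<close>\<close>

text \<open>The logarithm of \<open>2 * (x powr \<theta> * green x 0)\<^sup>2\<close> for
  \<open>x > 0\<close>; squaring removes the outer square root of the closed form.\<close>

definition log_profile :: "real \<Rightarrow> real \<Rightarrow> real" where
  "log_profile \<theta> x = (2 * \<theta> - 3/2) * ln x + ln (sqrt (x + 16) + sqrt x) - ln (x + 16)"

lemma profile_square:
  assumes "x > 0"
  shows "(x powr \<theta> * green x 0)\<^sup>2 = exp (log_profile \<theta> x) / 2"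
proof -
  have pos: "sqrt (x + 16) + sqrt x > 0" using assms by (simp add: add_pos_pos)
  have "(x powr \<theta> * green x 0)\<^sup>2
      = ((x powr \<theta>)\<^sup>2 / (x powr (3/4))\<^sup>2) * ((sqrt (x + 16) + sqrt x) / (x + 16)) / 2"
    unfolding green_zero[OF assms] using assms pos by (simp add: power_mult_distrib power_divide)
       (use assms in \<open>simp add: divide_simps algebra_simps\<close>)
  also have "(x powr \<theta>)\<^sup>2 / (x powr (3/4))\<^sup>2 = x powr (2 * \<theta> - 3/2)"
    using assms by (simp add: powr_powr powr_diff[symmetric] powr_realpow[symmetric] mult.commute)
  finally show ?thesis
    using assms pos by (simp add: log_profile_def exp_diff exp_add powr_def)
qed

lemma log_profile_deriv:
  assumes "x > 0"
  shows "(log_profile \<theta> has_real_derivative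
     (2 * \<theta> - 3/2 + sqrt (x / (x + 16)) / 2 - (sqrt (x / (x + 16)))\<^sup>2) / x) (at x)"
proof -
  define m p where "m = sqrt x" and "p = sqrt (x + 16)"
  have m: "m > 0" "m * m = x" and p: "p > 0" "p * p = x + 16" using assms by (simp_all add: m_def p_def)
  have dm: "(sqrt has_real_derivative 1 / (2 * m)) (at x)"
    using DERIV_real_sqrt[OF assms] by (simp add: m_def field_simps)
  have dp: "((\<lambda>x. sqrt (x + 16)) has_real_derivative 1 / (2 * p)) (at x)"
    using DERIV_real_sqrt[of "x + 16"] assms by (simp add: DERIV_shift[symmetric] p_def field_simps)
  have dln: "((\<lambda>x. ln (sqrt (x + 16) + sqrt x)) has_real_derivative
      1 / (p + m) * (1 / (2 * p) + 1 / (2 * m))) (at x)"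
    using DERIV_chain2[OF DERIV_ln_divide[of "p + m", unfolded p_def m_def] DERIV_add[OF dp dm]] add_pos_pos[OF p(1) m(1)]
    by (simp add: p_def m_def)
  have dln16: "((\<lambda>x. ln (x + 16)) has_real_derivative 1 / (x + 16)) (at x)"
    using assms by (auto intro!: derivative_eq_intros)
  have "(log_profile \<theta> has_real_derivative
      (2 * \<theta> - 3/2) * (1 / x) + 1 / (p + m) * (1 / (2 * p) + 1 / (2 * m)) - 1 / (x + 16)) (at x)"
    unfolding log_profile_def[abs_def]
    by (intro DERIV_diff DERIV_add DERIV_cmult DERIV_ln_divide assms dln dln16)
  \<comment> \<open>The sum \<open>p + m\<close> cancels and leaves \<open>1 / (2 * p * m)\<close>;
    here \<open>m / p\<close> is the square root in the claim.\<close>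
  moreover have "1 / (p + m) * (1 / (2 * p) + 1 / (2 * m)) = sqrt (x / (x + 16)) / 2 / x"
  proof -
    have "1 / (2 * p) + 1 / (2 * m) = (p + m) / (2 * p * m)"
      using m(1) p(1) by (simp add: field_simps)
    then have "1 / (p + m) * (1 / (2 * p) + 1 / (2 * m)) = 1 / (2 * p * m)" using m(1) p(1) by simp
    also have "\<dots> = m / p / 2 / (m * m)" using m(1) p(1) by (simp add: field_simps)
    finally show ?thesis unfolding m(2) by (simp add: m_def p_def real_sqrt_divide)
  qed
  moreover have "1 / (x + 16) = (sqrt (x / (x + 16)))\<^sup>2 / x" using assms by simp
  ultimately show ?thesis by (simp add: add_divide_distrib diff_divide_distrib)
qed

text \<open>Here \<open>s\<close> is the positive root of the quadratic in \<open>t\<close> that is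
  factored in the last claim; the other root \<open>1/2 - s\<close> is at most 0. Solving
  \<open>sqrt (x / (x + 16)) = s\<close> for \<open>x\<close> gives
  \<open>16 * s\<^sup>2 / (1 - s\<^sup>2)\<close>.\<close>

lemma lambda_star_param:
  assumes \<theta>: "3/4 \<le> \<theta>" "\<theta> < 1"
  defines "s \<equiv> (1 + sqrt (32 * \<theta> - 23)) / 4"
  shows "1/2 \<le> s" "s < 1" "lambda_star \<theta> = 16 * s\<^sup>2 / (1 - s\<^sup>2)" "lambda_star \<theta> > 0"
    "2 * \<theta> - 3/2 + t / 2 - t\<^sup>2 = (s - t) * (t + s - 1/2)"
proof -
  define r where "r = sqrt (32 * \<theta> - 23)"
  have r2: "r\<^sup>2 = 32 * \<theta> - 23" using \<theta> by (simp add: r_def)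
  then have th: "\<theta> = (r\<^sup>2 + 23) / 32" by simp
  have r1: "1 \<le> r" using \<theta> by (simp add: r_def)
  have "r\<^sup>2 < 3\<^sup>2" using r2 \<theta> by simp
  then have r3: "r < 3" by (rule power2_less_imp_less) simp
  have s: "s = (1 + r) / 4" by (simp add: s_def r_def)
  show s12: "1/2 \<le> s" "s < 1" using r1 r3 by (simp_all add: s)
  \<comment> \<open>In terms of \<open>r\<close> the numerator and the denominator factor, with
    \<open>(3 + r) * (5 - r)\<close> in common.\<close>
  have num: "64 * \<theta> - 32 * \<theta>\<^sup>2 - 29 + r = (1 + r)\<^sup>2 * ((3 + r) * (5 - r)) / 32"
    unfolding th by (simp add: power2_eq_square field_simps)
  have den: "2 * \<theta>\<^sup>2 - 5 * \<theta> + 3 = (3 - r) * (5 + r) * ((3 + r) * (5 - r)) / 512"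
    unfolding th by (simp add: power2_eq_square field_simps)
  have nz: "(3 + r) * (5 - r) \<noteq> 0" "(3 - r) * (5 + r) \<noteq> 0" using r1 r3 by auto
  have "lambda_star \<theta> = 16 * (1 + r)\<^sup>2 / ((3 - r) * (5 + r))"
    unfolding lambda_star_def r_def[symmetric] num den using nz by (simp add: divide_simps)
  also have "\<dots> = 16 * s\<^sup>2 / (1 - s\<^sup>2)"
  proof -
    have "1 - s\<^sup>2 = (3 - r) * (5 + r) / 16" by (simp add: s power2_eq_square field_simps)
    moreover have "s\<^sup>2 = (1 + r)\<^sup>2 / 16" by (simp add: s power_divide)
    ultimately show ?thesis by (simp only:) simp
  qed
  finally show eq: "lambda_star \<theta> = 16 * s\<^sup>2 / (1 - s\<^sup>2)" .
  have "s\<^sup>2 < 1" using s12 by (simp add: abs_square_less_1)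
  then show "lambda_star \<theta> > 0" unfolding eq using s12 by simp
  show "2 * \<theta> - 3/2 + t / 2 - t\<^sup>2 = (s - t) * (t + s - 1/2)"
    unfolding s th by (simp add: power2_eq_square field_simps)
qed

text \<open>The derivative of \<open>log_profile\<close> has the sign of \<open>s - t\<close>, where
  \<open>t = sqrt (x / (x + 16))\<close> increases with \<open>x\<close> and equals \<open>s\<close>
  at \<open>lambda_star \<theta>\<close>. So the profile rises strictly before that point and falls
  strictly after it.\<close>

lemma profile_max:
  assumes \<theta>: "3/4 \<le> \<theta>" "\<theta> < 1" and x: "x > 0" "x \<noteq> lambda_star \<theta>"
  shows "x powr \<theta> * green x 0 < lambda_star \<theta> powr \<theta> * green (lambda_star \<theta>) 0"
proof -
  define s where "s = (1 + sqrt (32 * \<theta> - 23)) / 4"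
  let ?L = "lambda_star \<theta>"
  note par = lambda_star_param[OF \<theta>, folded s_def]
  have s2: "s\<^sup>2 < 1" using par by (simp add: abs_square_less_1)
  have L16: "s = sqrt (?L / (?L + 16))"
  proof -
    have "?L / (?L + 16) = s\<^sup>2" using s2 unfolding par(3) by (simp add: field_simps)
    then show ?thesis using par by simp
  qed
  define D where "D y = (2 * \<theta> - 3/2 + sqrt (y / (y + 16)) / 2 - (sqrt (y / (y + 16)))\<^sup>2) / y" for y
  have D: "(log_profile \<theta> has_real_derivative D y) (at y)" if "y > 0" for y
    using log_profile_deriv[OF that] by (simp add: D_def)
  have mono: "sqrt (a / (a + 16)) < sqrt (b / (b + 16))" if "0 < a" "a < b" for a b :: real
    using that by (simp add: divide_simps) (simp add: algebra_simps)
  have D': "D y = (s - sqrt (y / (y + 16))) * (sqrt (y / (y + 16)) + s - 1/2) / y" for y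
    by (simp only: D_def par(5))
  have up: "D y > 0" if "0 < y" "y < ?L" for y
  proof -
    have "sqrt (y / (y + 16)) > 0" using that by simp
    then have "sqrt (y / (y + 16)) + s - 1/2 > 0" using par(1) by linarith
    then show ?thesis using mono[OF that] that unfolding D' L16[symmetric]
      by (intro divide_pos_pos mult_pos_pos) auto
  qed
  have down: "D y < 0" if "?L < y" for y
  proof -
    have y: "y > 0" using that par(4) by simp
    then have "sqrt (y / (y + 16)) > 0" by simp
    then have "sqrt (y / (y + 16)) + s - 1/2 > 0" using par(1) by linarith
    then show ?thesis using mono[OF par(4) that] y unfolding D' L16[symmetric]
      by (intro divide_neg_pos mult_neg_pos) auto
  qed
  have cont: "continuous_on S (log_profile \<theta>)" if "S \<subseteq> {0<..}" for S
    using that D by (intro continuous_at_imp_continuous_on ballI DERIV_isCont) auto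
  have "log_profile \<theta> x < log_profile \<theta> ?L"
  proof (cases "x < ?L")
    case True
    then show ?thesis
    proof (rule DERIV_pos_imp_increasing_open)
      show "\<exists>z. (log_profile \<theta> has_real_derivative z) (at y) \<and> 0 < z" if "x < y" "y < ?L" for y
        using that x(1) D[of y] up[of y] by fastforce
    qed (use x in \<open>auto intro: cont\<close>)
  next
    case False
    then have "?L < x" using x by simp
    then show ?thesis
    proof (rule DERIV_neg_imp_decreasing_open)
      show "\<exists>z. (log_profile \<theta> has_real_derivative z) (at y) \<and> z < 0" if "?L < y" "y < x" for y
        using that par(4) D[of y] down[of y] by fastforce
    qed (use par(4) in \<open>auto intro: cont\<close>)
  qed
  then have "(x powr \<theta> * green x 0)\<^sup>2 < (?L powr \<theta> * green ?L 0)\<^sup>2"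
    by (simp add: profile_square[OF x(1)] profile_square[OF par(4)])
  then show ?thesis
    by (rule power2_less_imp_less) (simp add: green_zero_pos[OF par(4)] less_imp_le)
qed

section \<open>Sharp constants and extremals\<close>

text \<open>Kept apart from \<open>K12\<close> until the least admissible constant is known to
  exist.\<close>

definition sharp_const :: "real \<Rightarrow> real" where
  "sharp_const \<theta> = young_const \<theta> * (lambda_star \<theta> powr \<theta> * green (lambda_star \<theta>) 0)"

text \<open>Any competing constant is tested at \<open>u\<close>, where the positive factor
  \<open>interp \<theta> u\<close> cancels.\<close>

lemma K12_eqI:
  assumes "admissible \<theta> C" "u \<in> l2" "u \<noteq> (\<lambda>n. 0)" "(u 0)\<^sup>2 = C * interp \<theta> u"
  shows "K12 \<theta> = C"
  unfolding K12_def
proof (rule Least_equality)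
  fix C' assume "admissible \<theta> C'"
  then have "C * interp \<theta> u \<le> C' * interp \<theta> u"
    using assms by (auto simp: admissible_def)
  then show "C \<le> C'" using interp_pos(3)[OF assms(2,3)] by simp
qed fact

text \<open>The exponents of the two squared norms add up to 1, so \<open>interp\<close> is
  homogeneous of degree 2.\<close>

lemma interp_scale:
  assumes "u \<in> l2" "u \<noteq> (\<lambda>n. 0)" "c \<noteq> 0" "(u 0)\<^sup>2 = C * interp \<theta> u"
  shows "(c * u 0)\<^sup>2 = C * interp \<theta> (\<lambda>n. c * u n)"
proof -
  have "ip (\<lambda>n. c * v n) (\<lambda>n. c * v n) = c\<^sup>2 * ip v v" for v
    by (simp add: ip_self l2norm_def infsum_nonneg power_mult_distrib infsum_cmult_right')
  moreover have "laplace (\<lambda>n. c * u n) = (\<lambda>n. c * laplace u n)"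
    by (auto simp: laplace_def algebra_simps)
  ultimately have "interp \<theta> (\<lambda>n. c * u n)
      = (c\<^sup>2 * ip u u) powr \<theta> * (c\<^sup>2 * ip (laplace u) (laplace u)) powr (1 - \<theta>)"
    by (simp add: interp_ip)
  also have "\<dots> = ((c\<^sup>2) powr \<theta> * (c\<^sup>2) powr (1 - \<theta>)) * interp \<theta> u"
    using interp_pos[OF assms(1,2)] by (simp add: powr_mult interp_ip)
  also have "(c\<^sup>2) powr \<theta> * (c\<^sup>2) powr (1 - \<theta>) = c\<^sup>2"
    using assms(3) by (simp add: powr_add[symmetric])
  finally show ?thesis by (simp add: power_mult_distrib assms(4))
qed

context
  fixes \<theta> :: real
  assumes \<theta>: "3/4 \<le> \<theta>" "\<theta> < 1"
begin

lemma lambda_star_pos: "lambda_star \<theta> > 0"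
  by (rule lambda_star_param(4)[OF \<theta>])

text \<open>The parameter \<open>l\<close> from \<open>green_upper_bound\<close> depends on
  \<open>u\<close>; maximising over all parameters removes this dependence. The maximum is strict,
  so equality forces \<open>l = lambda_star \<theta>\<close> and then equality in the energy
  bound.\<close>

lemma
  assumes u: "u \<in> l2" "u \<noteq> (\<lambda>n. 0)"
  shows sharp_inequality: "(u 0)\<^sup>2 \<le> sharp_const \<theta> * interp \<theta> u"
    and sharp_inequality_eq: "(u 0)\<^sup>2 = sharp_const \<theta> * interp \<theta> u
      \<Longrightarrow> u = (\<lambda>n. u 0 / green (lambda_star \<theta>) 0 * green (lambda_star \<theta>) n)"
proof -
  have \<theta>': "0 < \<theta>" "\<theta> < 1" using \<theta> by auto
  obtain l where l: "l > 0" "(u 0)\<^sup>2 \<le> young_const \<theta> * (l powr \<theta> * green l 0) * interp \<theta> u"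
    "(u 0)\<^sup>2 = young_const \<theta> * (l powr \<theta> * green l 0) * interp \<theta> u
      \<Longrightarrow> u = (\<lambda>n. u 0 / green l 0 * green l n)"
    using green_upper_bound[OF \<theta>' u] by blast
  have strict: "young_const \<theta> * (l powr \<theta> * green l 0) * interp \<theta> u < sharp_const \<theta> * interp \<theta> u"
    if "l \<noteq> lambda_star \<theta>"
    unfolding sharp_const_def
    by (intro mult_strict_right_mono mult_strict_left_mono profile_max \<theta> l that young_const_pos \<theta>' interp_pos u)
  show "(u 0)\<^sup>2 \<le> sharp_const \<theta> * interp \<theta> u"
    using l(2) strict by (cases "l = lambda_star \<theta>") (auto simp: sharp_const_def)
  assume "(u 0)\<^sup>2 = sharp_const \<theta> * interp \<theta> u"
  with l strict have "l = lambda_star \<theta>" by fastforce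
  with l \<open>(u 0)\<^sup>2 = _\<close> show "u = (\<lambda>n. u 0 / green (lambda_star \<theta>) 0 * green (lambda_star \<theta>) n)"
    by (simp add: sharp_const_def)
qed

text \<open>Testing the inequality for every parameter \<open>l\<close> against the extremal for \<open>L = lambda_star \<theta>\<close> shows that
  \<open>(A + l * B) * L powr \<theta> - green L 0 * l powr \<theta>\<close> is minimal at \<open>l = L\<close>; its critical point equation is the
  equality case of Young's inequality.\<close>
lemma green_lambda_star_attains:
  "(green (lambda_star \<theta>) 0)\<^sup>2 = sharp_const \<theta> * interp \<theta> (green (lambda_star \<theta>))"
proof -
  define L where "L = lambda_star \<theta>"
  define A B g where "A = ip (laplace (green L)) (laplace (green L))"
    and "B = ip (green L) (green L)" and "g = green L 0"
  have L: "L > 0" using lambda_star_pos by (simp add: L_def)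
  note G = green_l2[OF L] green_nonzero[OF L]
  have pos: "A > 0" "B > 0" using interp_pos[OF G] by (simp_all add: A_def B_def)
  have g: "g > 0" using green_zero_pos[OF L] by (simp add: g_def)
  have gAB: "g = A + L * B" using green_reproducing[OF L G(1)] by (simp add: A_def B_def g_def)
  define \<phi> where "\<phi> l = (A + l * B) * L powr \<theta> - g * l powr \<theta>" for l
  have \<phi>0: "\<phi> L = 0" by (simp add: \<phi>_def gAB)
  have \<phi>: "\<phi> l \<ge> 0" if l: "l > 0" for l
  proof -
    \<comment> \<open>Maximality at \<open>L\<close> is chained with the energy bound for
      \<open>green L\<close> at parameter \<open>l\<close>; a factor \<open>g\<close> is then
      cancelled.\<close>
    have "l powr \<theta> * green l 0 \<le> L powr \<theta> * g"
      using profile_max[OF \<theta> l] unfolding L_def g_def by (cases "l = L") (auto simp: L_def)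
    then have "(A + l * B) * (l powr \<theta> * green l 0) \<le> (A + l * B) * (L powr \<theta> * g)"
      using pos l by (intro mult_left_mono) auto
    moreover have "l powr \<theta> * g\<^sup>2 \<le> l powr \<theta> * (green l 0 * (A + l * B))"
      using green_inequality[OF l G(1)] by (intro mult_left_mono) (auto simp: g_def A_def B_def)
    ultimately have "g * (g * l powr \<theta>) \<le> g * ((A + l * B) * L powr \<theta>)"
      by (simp add: power2_eq_square algebra_simps)
    then show ?thesis using g by (simp add: \<phi>_def)
  qed
  have "(\<phi> has_real_derivative B * L powr \<theta> - g * (\<theta> * L powr (\<theta> - 1))) (at L)"
    unfolding \<phi>_def using L by (auto intro!: derivative_eq_intros)
  \<comment> \<open>The radius \<open>L\<close> keeps \<open>y\<close> positive, where
    \<open>\<phi>\<close> is nonnegative.\<close>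
  moreover have "\<forall>y. \<bar>L - y\<bar> < L \<longrightarrow> \<phi> L \<le> \<phi> y"
    using \<phi> \<phi>0 by auto
  ultimately have "B * L powr \<theta> - g * (\<theta> * L powr (\<theta> - 1)) = 0"
    using L by (metis DERIV_local_min)
  then have LB: "L * B = \<theta> * g"
    using L by (simp add: powr_diff field_simps)
  have A: "A = g - \<theta> * g" using gAB LB by simp
  have "(1 - \<theta>) * (L * B) = \<theta> * A" unfolding LB A by (simp add: algebra_simps)
  from young_eq[OF _ \<theta>(2) pos L this] \<theta>
  have "g = young_const \<theta> * L powr \<theta> * (B powr \<theta> * A powr (1 - \<theta>))"
    by (simp add: gAB)
  then have "g * g = young_const \<theta> * L powr \<theta> * (B powr \<theta> * A powr (1 - \<theta>)) * g"
    by simp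
  then show ?thesis
    by (simp add: sharp_const_def interp_ip A_def B_def g_def L_def power2_eq_square algebra_simps)
qed

lemma admissible_sharp_const: "admissible \<theta> (sharp_const \<theta>)"
  unfolding admissible_def
proof
  fix u assume "u \<in> l2"
  then show "(u 0)\<^sup>2 \<le> sharp_const \<theta> * interp \<theta> u"
    using sharp_inequality by (cases "u = (\<lambda>n. 0)") (auto simp: interp_ip ip_def)
qed

lemma K12_eq_sharp_const: "K12 \<theta> = sharp_const \<theta>"
  using admissible_sharp_const green_l2 green_nonzero green_lambda_star_attains lambda_star_pos
  by (intro K12_eqI) auto

lemma extremal_iff:
  "{u. extremal \<theta> u} = {\<lambda>n. c * green (lambda_star \<theta>) n | c. c \<noteq> 0}" (is "?E = ?F")
proof (intro equalityI subsetI)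
  let ?G = "green (lambda_star \<theta>)"
  note G = green_l2[OF lambda_star_pos] green_nonzero[OF lambda_star_pos]
  show "u \<in> ?F" if "u \<in> ?E" for u
  proof -
    have u: "u \<in> l2" "u \<noteq> (\<lambda>n. 0)" "(u 0)\<^sup>2 = sharp_const \<theta> * interp \<theta> u"
      using that by (auto simp: extremal_def K12_eq_sharp_const)
    from sharp_inequality_eq[OF this] obtain c where c: "u = (\<lambda>n. c * ?G n)" by blast
    with u(2) have "c \<noteq> 0" by auto
    with c show ?thesis by blast
  qed
  show "u \<in> ?E" if "u \<in> ?F" for u
  proof -
    from that obtain c where c: "c \<noteq> 0" "u = (\<lambda>n. c * ?G n)" by blast
    then have "u \<noteq> (\<lambda>n. 0)" using G(2) by (auto simp: fun_eq_iff)
    then show ?thesis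
      using l2_scale[OF G(1), of c] interp_scale[OF G c(1) green_lambda_star_attains]
      by (simp add: extremal_def K12_eq_sharp_const c(2))
  qed
qed

end

section \<open>The endpoint \<open>\<theta> = 1\<close>\<close>

text \<open>For \<open>u\<close> nonzero the factor with exponent 0 is 1, since
  \<open>laplace u\<close> is nonzero; for \<open>u = 0\<close> both sides are 0 despite
  \<open>0 powr 0 = 0\<close>.\<close>

lemma interp_1: "u \<in> l2 \<Longrightarrow> interp 1 u = ip u u"
  using interp_pos[of u] by (cases "u = (\<lambda>n. 0)") (auto simp: interp_ip ip_def)

text \<open>Pythagoras: \<open>u 0 * delta\<close> is the orthogonal projection of \<open>u\<close>
  onto the line of \<open>delta\<close>. This yields both the bound with constant 1 and its equality
  case.\<close>

lemma delta_distance: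
  assumes "u \<in> l2"
  shows "ip (\<lambda>n. u n - u 0 * delta n) (\<lambda>n. u n - u 0 * delta n) = ip u u - (u 0)\<^sup>2"
  unfolding ip_diff_scale_self[OF assms delta_l2]
  by (simp add: ip_delta delta_def power2_eq_square)

lemma delta_nonzero: "delta \<noteq> (\<lambda>n. 0)"
  by (auto simp: delta_def fun_eq_iff)

lemma admissible_1: "admissible 1 1"
  unfolding admissible_def
proof
  fix u assume u: "u \<in> l2"
  show "(u 0)\<^sup>2 \<le> 1 * interp 1 u"
    using ip_self_nonneg[of "\<lambda>n. u n - u 0 * delta n"] delta_distance[OF u] interp_1[OF u] by simp
qed

lemma delta_attains: "(delta 0)\<^sup>2 = 1 * interp 1 delta"
  by (simp add: interp_1 delta_l2 ip_delta delta_def)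

lemma K12_1: "K12 1 = 1"
  by (rule K12_eqI[OF admissible_1 delta_l2 delta_nonzero delta_attains])

lemma extremal_1_iff: "{u. extremal 1 u} = {\<lambda>n. c * delta n | c. c \<noteq> 0}" (is "?E = ?F")
proof (intro equalityI subsetI)
  show "u \<in> ?F" if "u \<in> ?E" for u
  proof -
    have u: "u \<in> l2" "u \<noteq> (\<lambda>n. 0)" "(u 0)\<^sup>2 = ip u u"
      using that by (auto simp: extremal_def K12_1 interp_1)
    have "(\<lambda>n. u n - u 0 * delta n) = (\<lambda>n. 0)"
      by (intro ip_self_eq_0 l2_diff l2_scale delta_l2) (simp_all add: u delta_distance)
    then have c: "u n = u 0 * delta n" for n by (metis eq_iff_diff_eq_0)
    from u(2) obtain n where "u n \<noteq> 0" by (auto simp: fun_eq_iff)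
    with c[of n] have "u 0 \<noteq> 0" by auto
    moreover have "u = (\<lambda>n. u 0 * delta n)" by (rule ext) (rule c)
    ultimately show ?thesis by (intro CollectI exI[of _ "u 0"] conjI)
  qed
  show "u \<in> ?E" if "u \<in> ?F" for u
  proof -
    from that obtain c where c: "c \<noteq> 0" "u = (\<lambda>n. c * delta n)" by blast
    then have "u \<noteq> (\<lambda>n. 0)" using delta_nonzero by (auto simp: fun_eq_iff)
    then show ?thesis
      using l2_scale[OF delta_l2, of c] interp_scale[OF delta_l2 delta_nonzero c(1) delta_attains]
      by (simp add: extremal_def K12_1 c(2))
  qed
qed

section \<open>The limiting case \<open>\<theta> = 3/4\<close>\<close>

lemma sharp_const_three_quarters: "sharp_const (3/4) = sqrt 2 / 2"
proof -
  let ?L = "16/3 :: real"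
  have L: "lambda_star (3/4) = ?L"
    by (simp add: lambda_star_def power2_eq_square)
  have "sqrt (?L + 16) = 2 * sqrt ?L"
    using real_sqrt_mult[of 4 ?L] by simp
  moreover have "sqrt ?L = 4 * sqrt 3 / 3"
    by (rule real_sqrt_unique) (simp_all add: power2_eq_square)
  ultimately have q: "(sqrt (?L + 16) + sqrt ?L) / (?L + 16) = 3 * sqrt 3 / 16"
    by simp
  \<comment> \<open>This is the denominator of \<open>young_const (3/4)\<close>. The radical in
    \<open>green ?L 0\<close> turns out to equal it, so everything but \<open>sqrt 2 / 2\<close>
    cancels.\<close>
  define y :: real where "y = (3/4) powr (3/4) * (1/4) powr (1/4)"
  have y: "y > 0" by (simp add: y_def)
  have "y\<^sup>2 = (3/4) powr (3/2) * (1/4) powr (1/2)"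
    by (simp add: y_def power_mult_distrib powr_realpow[symmetric] powr_powr)
  also have "(3/4::real) powr (3/2) = (3/4) powr (1 + 1/2)" by simp
  also have "\<dots> = 3/4 * sqrt (3/4)" by (subst powr_add) (simp add: powr_half_sqrt)
  also have "(1/4::real) powr (1/2) = 1/2" by (simp add: powr_half_sqrt real_sqrt_divide)
  also have "3/4 * sqrt (3/4) * (1/2) = 3 * sqrt 3 / (16::real)" by (simp add: real_sqrt_divide)
  finally have "sqrt (3 * sqrt 3 / 16) = y" using y by (metis real_sqrt_unique less_imp_le)
  then have "green ?L 0 = sqrt 2 / 2 * (1 / ?L powr (3/4)) * y"
    using green_zero[of ?L] unfolding q by simp
  then show ?thesis
    using y by (simp add: sharp_const_def young_const_def L y_def)
qed

section \<open>Behaviour as \<open>\<theta>\<close> tends to 1 from the left\<close>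

lemma lambda_star_at_top: "filterlim lambda_star at_top (at_left 1)"
  unfolding lambda_star_def by real_asymp

text \<open>The energy \<open>green l 0\<close> of \<open>green l\<close> is at least
  \<open>l\<close> times its squared norm, hence at least
  \<open>l * (green l 0)\<^sup>2\<close>.\<close>

lemma green_zero_le:
  assumes "l > 0"
  shows "l * green l 0 \<le> 1"
proof -
  let ?G = "green l"
  note G = green_l2[OF assms]
  have "(?G 0)\<^sup>2 \<le> ip ?G ?G"
    using admissible_1 G by (auto simp: admissible_def interp_1)
  then have "l * (?G 0)\<^sup>2 \<le> l * ip ?G ?G" using assms by simp
  also have "\<dots> \<le> ?G 0"
    using green_reproducing[OF assms G] ip_self_nonneg[of "laplace ?G"] by linarith
  finally have "?G 0 * (l * ?G 0) \<le> ?G 0 * 1" by (simp add: power2_eq_square mult.left_commute)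
  then show ?thesis using green_zero_pos[OF assms] by (simp only: mult_le_cancel_left_pos)
qed

text \<open>The lower bound tests the inequality with \<open>delta\<close>, where \<open>l2norm (laplace delta) = sqrt 6\<close>.\<close>
lemma sharp_const_tendsto_1: "(sharp_const \<longlongrightarrow> 1) (at_left 1)"
proof (rule tendsto_sandwich)
  have ev: "\<forall>\<^sub>F \<theta> in at_left 1. \<theta> \<in> {3/4<..<1::real}"
    by (rule eventually_at_left_real) simp
  show "\<forall>\<^sub>F \<theta> in at_left 1. 6 powr (\<theta> - 1) \<le> sharp_const \<theta>"
    using ev
  proof eventually_elim
    case (elim \<theta>)
    have "ip (laplace delta) (laplace delta) = laplace (laplace delta) 0"
      by (simp add: ip_laplace l2_laplace delta_l2 ip_delta)
    also have "\<dots> = 6" by (simp add: laplace_def delta_def)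
    finally have "interp \<theta> delta = 6 powr (1 - \<theta>)"
      by (simp add: interp_ip ip_delta) (simp add: delta_def)
    moreover have "(delta 0)\<^sup>2 \<le> sharp_const \<theta> * interp \<theta> delta"
      using elim by (intro sharp_inequality delta_l2 delta_nonzero) auto
    ultimately have "1 \<le> sharp_const \<theta> * 6 powr (1 - \<theta>)" by (simp add: delta_def)
    then have "1 / 6 powr (1 - \<theta>) \<le> sharp_const \<theta>" by (simp add: divide_le_eq)
    then show ?case using powr_minus_divide[of 6 "1 - \<theta>"] by simp
  qed
  \<comment> \<open>For the upper bound, write \<open>?L powr \<theta>\<close> as
    \<open>?L powr (\<theta> - 1) * ?L\<close>: the first factor is at most 1 once
    \<open>?L \<ge> 1\<close>, and \<open>green_zero_le\<close> bounds the rest.\<close>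
  have "\<forall>\<^sub>F \<theta> in at_left 1. lambda_star \<theta> \<ge> 1"
    using lambda_star_at_top by (simp add: filterlim_at_top)
  with ev show "\<forall>\<^sub>F \<theta> in at_left 1. sharp_const \<theta> \<le> young_const \<theta>"
  proof eventually_elim
    case (elim \<theta>)
    let ?L = "lambda_star \<theta>"
    have L: "?L > 0" using elim by simp
    have "?L powr \<theta> * green ?L 0 = ?L powr (\<theta> - 1) * (?L * green ?L 0)"
      using L by (simp add: powr_diff)
    also have "\<dots> \<le> 1 * 1"
    proof (rule mult_mono)
      show "?L powr (\<theta> - 1) \<le> 1"
        using powr_mono[of "\<theta> - 1" 0 ?L] elim by simp
      show "?L * green ?L 0 \<le> 1" by (rule green_zero_le[OF L])
      show "0 \<le> ?L * green ?L 0" using L green_zero_pos[OF L] by simp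
    qed simp
    finally have "young_const \<theta> * (?L powr \<theta> * green ?L 0) \<le> young_const \<theta> * 1"
      using young_const_pos[of \<theta>] elim by (intro mult_left_mono) auto
    then show ?case by (simp add: sharp_const_def)
  qed
  show "((\<lambda>\<theta>::real. 6 powr (\<theta> - 1)) \<longlongrightarrow> 1) (at_left 1)" by real_asymp
  show "(young_const \<longlongrightarrow> 1) (at_left 1)"
    unfolding young_const_def by real_asymp
qed

theorem theorem5p1:
  shows "(\<forall>\<theta>\<in>{3/4..1::real}.
            admissible \<theta> (K12 \<theta>) \<and> (\<forall>C. admissible \<theta> C \<longrightarrow> K12 \<theta> \<le> C))
       \<and> (\<forall>u\<in>l2. (u 0)\<^sup>2 \<le> sqrt 2 / 2 * l2norm u powr (3/2) * l2norm (laplace u) powr (1/2))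
       \<and> K12 (3/4) = sqrt 2 / 2
       \<and> (\<forall>\<theta>\<in>{3/4..<1::real}.
            lambda_star \<theta> > 0
          \<and> K12 \<theta> = 1 / (\<theta> powr \<theta> * (1 - \<theta>) powr (1 - \<theta>))
                      * lambda_star \<theta> powr \<theta> * green (lambda_star \<theta>) 0)
       \<and> (\<forall>l>0::real. green l 0 =
            sqrt 2 / 2 * (1 / l powr (3/4)) * sqrt ((sqrt (l + 16) + sqrt l) / (l + 16)))
       \<and> (\<forall>\<theta>\<in>{3/4..<1::real}.
            {u. extremal \<theta> u} = {\<lambda>n. c * green (lambda_star \<theta>) n | c. c \<noteq> 0})
       \<and> filterlim lambda_star at_top (at_left 1)
       \<and> ((\<lambda>\<theta>. 1 / (\<theta> powr \<theta> * (1 - \<theta>) powr (1 - \<theta>))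
                 * lambda_star \<theta> powr \<theta> * green (lambda_star \<theta>) 0) \<longlongrightarrow> K12 1) (at_left 1)
       \<and> {u. extremal 1 u} = {\<lambda>n. c * delta n | c. c \<noteq> 0}"
proof (intro conjI ballI allI impI)
  fix \<theta> :: real
  assume "\<theta> \<in> {3/4..1}"
  then consider "\<theta> = 1" | "3/4 \<le> \<theta>" "\<theta> < 1" by fastforce
  then show "admissible \<theta> (K12 \<theta>)"
    using admissible_1 K12_1 admissible_sharp_const K12_eq_sharp_const by cases auto
next
  fix \<theta> C :: real
  assume th: "\<theta> \<in> {3/4..1}" and C: "admissible \<theta> C"
  then consider "\<theta> = 1" | "3/4 \<le> \<theta>" "\<theta> < 1" by fastforce
  \<comment> \<open>In either case a nonzero sequence attains the constant, and testing
    \<open>C\<close> on it gives minimality.\<close>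
  then obtain u where "u \<in> l2" "u \<noteq> (\<lambda>n. 0)" "(u 0)\<^sup>2 = K12 \<theta> * interp \<theta> u"
  proof cases
    case 1
    then show ?thesis using that[of delta] delta_l2 delta_nonzero delta_attains K12_1 by simp
  next
    case 2
    then show ?thesis
      using that[of "green (lambda_star \<theta>)"] green_l2 green_nonzero lambda_star_pos
        green_lambda_star_attains K12_eq_sharp_const by simp
  qed
  then show "K12 \<theta> \<le> C"
    using C interp_pos(3)[of u \<theta>] unfolding admissible_def
    by (metis mult_le_cancel_right_pos)
next
  fix u :: "int \<Rightarrow> real"
  assume "u \<in> l2"
  then show "(u 0)\<^sup>2 \<le> sqrt 2 / 2 * l2norm u powr (3/2) * l2norm (laplace u) powr (1/2)"
    using admissible_sharp_const[of "3/4"]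
    by (auto simp: admissible_def sharp_const_three_quarters interp_def mult.assoc)
next
  show "K12 (3/4) = sqrt 2 / 2"
    using K12_eq_sharp_const[of "3/4"] sharp_const_three_quarters by simp
next
  fix \<theta> :: real
  assume th: "\<theta> \<in> {3/4..<1}"
  then show "lambda_star \<theta> > 0" by (simp add: lambda_star_pos)
  from th show "K12 \<theta> = 1 / (\<theta> powr \<theta> * (1 - \<theta>) powr (1 - \<theta>))
                      * lambda_star \<theta> powr \<theta> * green (lambda_star \<theta>) 0"
    by (simp add: K12_eq_sharp_const sharp_const_def young_const_def)
  from th show "{u. extremal \<theta> u} = {\<lambda>n. c * green (lambda_star \<theta>) n | c. c \<noteq> 0}"
    by (simp add: extremal_iff)
next
  fix l :: real
  assume "l > 0"
  then show "green l 0 = sqrt 2 / 2 * (1 / l powr (3/4)) * sqrt ((sqrt (l + 16) + sqrt l) / (l + 16))"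
    by (rule green_zero)
next
  show "((\<lambda>\<theta>. 1 / (\<theta> powr \<theta> * (1 - \<theta>) powr (1 - \<theta>))
                 * lambda_star \<theta> powr \<theta> * green (lambda_star \<theta>) 0) \<longlongrightarrow> K12 1) (at_left 1)"
    using sharp_const_tendsto_1 by (simp add: K12_1 sharp_const_def[abs_def] young_const_def)
qed (fact lambda_star_at_top extremal_1_iff)+

end
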